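(* The unique numerical semigroup of multiplicity $12$ that is simultaneously a discretization of the logarithmic monoid $L$ and a discretization of the golden fractal monoid $F$ is the well-tempered harmonic semigroup $$H=\{0,12,19,24,28,31,34,36,38,40,42,43\}\cup\{i\in\mathbb{N}: i\ge 45\}.$$
   Context: $\mathbb{N}=\{1,2,3,\dots\}$ and $\mathbb{N}_0=\mathbb{N}\cup\{0\}$. A numerical semigroup is an additive submonoid of $\mathbb{N}_0$ (containing $0$) with finite complement in $\mathbb{N}_0$; its multiplicity is its smallest non-zero element. For $r\in\mathbb{R}$ and $\alpha\in[0,1]$, put $\lfloor r\rfloor_\alpha=\lfloor r\rfloor$ if $r-\lfloor r\rfloor<\alpha$, and $\lfloor r\rfloor_\alpha=\lceil r\rceil$ otherwise. For a set $M$ of real numbers and a positive integer $m$, $\lfloor mM\rfloor_\alpha=\{\lfloor mr\rfloor_\alpha: r\in M\}$. A numerical semigroup of multiplicity $m$ is a discretization of $M$ (for $M=L$ or $M=F$ below) if it equals $\lfloor mM\rfloor_\alpha$ for some $\alpha\in[0,1]$; the thresholds $\alpha$ used for $L$ and for $F$ may be different. The logarithmic monoid is $L=\{\log_2(i): i\in\mathbb{N}\}$. The golden fractal monoid $F$ is defined as follows. Let $\phi=\frac{1+\sqrt5}{2}$. Put $\pi_1=\{1,\phi\}$. Recursively, for $i\ge1$, if $\pi_i=\{i+\tau_0,i+\tau_1,\dots,i+\tau_{2^i-1}\}$ with $0=\tau_0<\tau_1<\dots<\tau_{2^i-1}<1$, and one sets $\tau_{2^i}=1$, then $$\pi_{i+1}=\bigcup_{r=0}^{2^i-1}\left\{(i+1)+\tau_r,\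 (i+1)+\tau_r+(\phi-1)(\tau_{r+1}-\tau_r)\right\}.$$ Then $F=\{0\}\cup\bigcup_{i\ge1}\pi_i$. *)

theory Defs
  imports Complex_Main
begin

definition numerical_semigroup :: "nat set \<Rightarrow> bool" where
  "numerical_semigroup S \<longleftrightarrow>
     0 \<in> S \<and> (\<forall>a\<in>S. \<forall>b\<in>S. a + b \<in> S) \<and> finite (- S)"

text \<open>For a numerical semigroup the set of non-zero elements is non-empty, so \<open>LEAST\<close> is meaningful.\<close>
definition semigroup_multiplicity :: "nat set \<Rightarrow> nat" where
  "semigroup_multiplicity S = (LEAST n. n \<in> S \<and> n \<noteq> 0)"

definition threshold_floor :: "real \<Rightarrow> real \<Rightarrow> int" where
  "threshold_floor \<alpha> r = (if r - of_int \<lfloor>r\<rfloor> < \<alpha> then \<lfloor>r\<rfloor> else \<lceil>r\<rceil>)"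

definition discretized :: "real \<Rightarrow> nat \<Rightarrow> real set \<Rightarrow> int set" where
  "discretized \<alpha> m M = {threshold_floor \<alpha> (real m * r) | r. r \<in> M}"

definition is_discretization :: "nat set \<Rightarrow> real set \<Rightarrow> bool" where
  "is_discretization S M \<longleftrightarrow>
     numerical_semigroup S \<and>
     (\<exists>\<alpha>\<in>{0..1}. int ` S = discretized \<alpha> (semigroup_multiplicity S) M)"

definition logarithmic_monoid :: "real set" where
  "logarithmic_monoid = {log 2 (real i) | i. i \<ge> 1}"

definition golden_ratio :: real where
  "golden_ratio = (1 + sqrt 5) / 2"

text \<open>The periods are indexed from \<open>1\<close>; index \<open>0\<close> is a dummy.  For a period \<open>P\<close> with index
  \<open>i = Suc n\<close>, the list \<open>\<tau>\<close> consists of the elements \<open>p - i\<close> for \<open>p \<in> P\<close> in increasing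
  order, followed by \<open>1\<close>.\<close>
fun golden_period :: "nat \<Rightarrow> real set" where
  "golden_period 0 = {}"
| "golden_period (Suc 0) = {1, golden_ratio}"
| "golden_period (Suc (Suc n)) =
     (let i = Suc n;
          \<tau> = sorted_list_of_set ((\<lambda>p. p - real i) ` golden_period (Suc n)) @ [1]
      in \<Union>r<2 ^ i. {real (i + 1) + \<tau> ! r,
                       real (i + 1) + \<tau> ! r + (golden_ratio - 1) * (\<tau> ! (r + 1) - \<tau> ! r)})"

definition golden_fractal_monoid :: "real set" where
  "golden_fractal_monoid = {0} \<union> (\<Union>i\<in>{1..}. golden_period i)"

definition well_tempered_harmonic_semigroup :: "nat set" where
  "well_tempered_harmonic_semigroup =
     {0, 12, 19, 24, 28, 31, 34, 36, 38, 40, 42, 43} \<union> {i. i \<ge> 45}"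

end

theory Submission
  imports Defs
begin

text \<open>
  Write \<open>H\<close> for the well-tempered harmonic semigroup, \<open>L\<close> and \<open>F\<close> for the logarithmic and the
  golden fractal monoid, and \<open>g = \<phi> - 1\<close>, so that \<open>g\<^sup>2 = 1 - g\<close>.
  Logarithms have base \<open>2\<close>.

  \<open>H\<close> discretizes both monoids. On the logarithmic side, the values \<open>12 log i\<close> for \<open>i \<le> 17\<close> round
  to \<open>0, 12, 19, 24, 28, 31, \<dots>, 48, 49\<close> for every threshold above the fractional part of
  \<open>12 log 17\<close> (about 0.05) and at most that of \<open>12 log 13\<close> (about 0.405). From \<open>i = 17\<close> on
  consecutive values differ by less than \<open>1\<close>, since \<open>(18/17)\<^sup>1\<^sup>2 < 2\<close>, so that no integer is
  skipped (\<open>discretized_log\<close>). On the golden side, threshold \<open>1\<close>, which is the ordinary floor,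
  works: the first three periods give the elements of \<open>H\<close> below \<open>48\<close>, and the fourth one already
  has, modulo \<open>1\<close>, a point in each of the twelve intervals \<open>[k/12, (k+1)/12)\<close>; all later periods
  contain a translate of it (\<open>discretized_golden\<close>).

  Conversely let \<open>S\<close> be a common discretization, with threshold \<open>\<alpha>\<close> for \<open>L\<close> and \<open>\<beta>\<close> for \<open>F\<close>. The
  number \<open>12 log 3 = 19.02\<close> rounds to \<open>19\<close> unless \<open>\<alpha>\<close> is tiny. In that case \<open>12 log 5 = 27.86\<close>
  rounds to \<open>28\<close>; as \<open>12 (3 - g) = 28.58\<close> is the only scaled element of \<open>F\<close> near \<open>28\<close>, it must be
  rounded down, and this forces \<open>12 (1 + g) = 19.42\<close> down to \<open>19\<close>. Thus \<open>19 \<in> S\<close> in any case.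
  Then \<open>38 = 19 + 19\<close> lies in the semigroup \<open>S\<close>, but the only scaled element of \<open>F\<close> near \<open>38\<close> has
  the large fractional part 0.83, so \<open>\<beta>\<close> exceeds it. Hence \<open>F\<close> puts \<open>34\<close>, \<open>45\<close> and \<open>49\<close> into \<open>S\<close>,
  and these three numbers confine \<open>\<alpha>\<close> to the interval for which \<open>L\<close> rounds to \<open>H\<close>
  (\<open>harmonic_thresholdI\<close>).
\<close>

section \<open>Rounding with a threshold\<close>

text \<open>
  Up to ties at integers, the numbers rounded to \<open>n\<close> form the interval \<open>[n - 1 + \<alpha>, n + \<alpha>)\<close>. The
  premise \<open>n - 1 < r\<close> is there for the threshold \<open>\<alpha> = 0\<close>, where that interval would wrongly include the
  integer \<open>n - 1\<close>.
\<close>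
lemma threshold_floor_eqI:
  assumes "of_int n - 1 < r" "of_int n - 1 + \<alpha> \<le> r" "r < of_int n + \<alpha>" "\<alpha> \<le> 1"
  shows "threshold_floor \<alpha> r = n"
proof (cases "of_int n \<le> r")
  case True
  then have "\<lfloor>r\<rfloor> = n" using assms by (simp add: floor_eq_iff)
  then show ?thesis using assms by (simp add: threshold_floor_def)
next
  case False
  then have "\<lfloor>r\<rfloor> = n - 1" "\<lceil>r\<rceil> = n" using assms by (simp_all add: floor_eq_iff ceiling_eq_iff)
  then show ?thesis using assms by (simp add: threshold_floor_def)
qed

lemma threshold_floor_one: "threshold_floor 1 r = \<lfloor>r\<rfloor>"
proof -
  have "r - of_int \<lfloor>r\<rfloor> < 1" by linarith
  then show ?thesis by (simp add: threshold_floor_def)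
qed

lemma threshold_floor_eqD:
  assumes "threshold_floor \<alpha> r = n"
  shows "of_int n - 1 < r" "r < of_int n + 1"
    "of_int n < r \<Longrightarrow> r < of_int n + \<alpha>" "r < of_int n \<Longrightarrow> of_int n - 1 + \<alpha> \<le> r"
proof -
  consider "r = of_int n" | "\<lfloor>r\<rfloor> = n" "r < of_int n + \<alpha>" | "\<lceil>r\<rceil> = n" "\<lfloor>r\<rfloor> = n - 1" "of_int n - 1 + \<alpha> \<le> r"
  proof (cases "r - of_int \<lfloor>r\<rfloor> < \<alpha>")
    case False
    then have c: "\<lceil>r\<rceil> = n" using assms by (simp add: threshold_floor_def)
    show ?thesis
    proof (cases "r = of_int \<lfloor>r\<rfloor>")
      case True
      then have "r = of_int n" using c by (metis ceiling_of_int)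
      then show ?thesis using that by blast
    next
      case neq: False
      then have "\<lfloor>r\<rfloor> = n - 1" using c by (simp add: ceiling_altdef split: if_splits)
      then show ?thesis using that(3) c False by simp
    qed
  qed (use assms that(2) in \<open>simp add: threshold_floor_def\<close>)
  then show "of_int n - 1 < r" "r < of_int n + 1"
    "of_int n < r \<Longrightarrow> r < of_int n + \<alpha>" "r < of_int n \<Longrightarrow> of_int n - 1 + \<alpha> \<le> r"
    by (cases; auto simp: floor_eq_iff ceiling_eq_iff)+
qed

lemma mem_discretized_nat:
  assumes "int ` S = discretized \<alpha> m M"
  shows "n \<in> S \<longleftrightarrow> (\<exists>x\<in>M. threshold_floor \<alpha> (real m * x) = int n)"
proof -
  have "n \<in> S \<longleftrightarrow> int n \<in> int ` S" by auto
  then show ?thesis unfolding assms discretized_def by auto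
qed

lemma int_mem_harmonic_iff:
  "z \<in> int ` well_tempered_harmonic_semigroup
     \<longleftrightarrow> z \<in> {0, 12, 19, 24, 28, 31, 34, 36, 38, 40, 42, 43} \<or> 45 \<le> z"
proof -
  have "z \<in> int ` S \<longleftrightarrow> 0 \<le> z \<and> nat z \<in> S" for S
    by (auto simp: image_iff intro: bexI[of _ "nat z"])
  then show ?thesis by (auto simp: well_tempered_harmonic_semigroup_def nat_eq_iff)
qed

section \<open>Discretizing the logarithmic monoid\<close>

text \<open>
  All comparisons between fractional parts of the numbers \<open>12 log i\<close> become inequalities between
  natural numbers, which the simplifier decides by evaluation.
\<close>
lemma log_compare:
  assumes "i \<ge> 1" "j \<ge> 1"
  shows "12 * log 2 (real i) + real m \<le> 12 * log 2 (real j) + real n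
         \<longleftrightarrow> i ^ 12 * 2 ^ m \<le> j ^ 12 * 2 ^ n"
proof -
  have eq: "12 * log 2 (real k) + real l = log 2 (real (k ^ 12 * 2 ^ l))" if "k \<ge> 1" for k l :: nat
    using that by (simp add: log_mult log_nat_power)
  have "12 * log 2 (real i) + real m \<le> 12 * log 2 (real j) + real n
      \<longleftrightarrow> real (i ^ 12 * 2 ^ m) \<le> real (j ^ 12 * 2 ^ n)"
    unfolding eq[OF assms(1)] eq[OF assms(2)] using assms by (intro log_le_cancel_iff) auto
  then show ?thesis by (simp only: of_nat_le_iff)
qed

lemma log_ge_iff: "i \<ge> 1 \<Longrightarrow> real n \<le> 12 * log 2 (real i) \<longleftrightarrow> 2 ^ n \<le> i ^ 12"
  using log_compare[of 1 i n 0] by simp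

lemma log_le_iff: "i \<ge> 1 \<Longrightarrow> 12 * log 2 (real i) \<le> real n \<longleftrightarrow> i ^ 12 \<le> 2 ^ n"
  using log_compare[of i 1 0 n] by simp

text \<open>
  The two bounds are the fractional parts of \<open>12 log 17\<close> and \<open>12 log 13\<close>. For \<open>i \<le> 17\<close>, the
  former is the largest one among the values \<open>12 log i\<close> that must be rounded down to give the
  harmonic semigroup, and the latter is the smallest one among those that must be rounded up.
\<close>
definition harmonic_threshold :: "real \<Rightarrow> bool" where
  "harmonic_threshold \<alpha> \<longleftrightarrow> 12 * log 2 (real 17) - 49 < \<alpha> \<and> \<alpha> \<le> 12 * log 2 (real 13) - 44"

lemma harmonic_threshold_bounds:
  assumes "harmonic_threshold \<alpha>" shows "0 < \<alpha>" "\<alpha> < 1"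
  using assms log_ge_iff[of 17 49] log_ge_iff[of 13 45] unfolding harmonic_threshold_def
  by simp_all

text \<open>
  The last premise compares fractional parts: that of \<open>12 log i\<close>, measured from \<open>n\<close>, is at most
  that of \<open>12 log 17\<close>.
\<close>
lemma threshold_log_down:
  assumes "harmonic_threshold \<alpha>" "i \<ge> 1" "2 ^ n \<le> i ^ 12" "i ^ 12 * 2 ^ 49 \<le> 17 ^ 12 * 2 ^ n"
  shows "threshold_floor \<alpha> (12 * log 2 (real i)) = int n"
proof (rule threshold_floor_eqI)
  show "12 * log 2 (real i) < real_of_int (int n) + \<alpha>"
    using assms log_compare[of i 17 49 n] by (simp add: harmonic_threshold_def)
qed (use assms harmonic_threshold_bounds[of \<alpha>] log_ge_iff[of i n] in auto)

text \<open>
  Dually, the last premise says that \<open>12 log i\<close> exceeds \<open>n\<close> by at least the fractional part of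
  \<open>12 log 13\<close>.
\<close>
lemma threshold_log_up:
  assumes "harmonic_threshold \<alpha>" "i \<ge> 1" "i ^ 12 \<le> 2 ^ Suc n" "13 ^ 12 * 2 ^ n \<le> i ^ 12 * 2 ^ 44"
  shows "threshold_floor \<alpha> (12 * log 2 (real i)) = int (Suc n)"
proof (rule threshold_floor_eqI)
  show le: "real_of_int (int (Suc n)) - 1 + \<alpha> \<le> 12 * log 2 (real i)"
    using assms log_compare[of 13 i n 44] by (simp add: harmonic_threshold_def)
  then show "real_of_int (int (Suc n)) - 1 < 12 * log 2 (real i)"
    using harmonic_threshold_bounds[OF assms(1)] by linarith
qed (use assms harmonic_threshold_bounds[of \<alpha>] log_le_iff[of i "Suc n"] in auto)

lemma threshold_log_small:
  assumes "harmonic_threshold \<alpha>"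
  defines "T \<equiv> \<lambda>i. threshold_floor \<alpha> (12 * log 2 (real i))"
  shows "T 1 = 0" "T 2 = 12" "T 3 = 19" "T 4 = 24" "T 5 = 28" "T 6 = 31" "T 7 = 34" "T 8 = 36"
    "T 9 = 38" "T 10 = 40" "T 11 = 42" "T 12 = 43" "T 13 = 45" "T 14 = 46" "T 15 = 47" "T 16 = 48"
  unfolding T_def
  using threshold_log_down[OF assms(1), of 1 0] threshold_log_down[OF assms(1), of 2 12]
    threshold_log_down[OF assms(1), of 3 19] threshold_log_down[OF assms(1), of 4 24]
    threshold_log_up[OF assms(1), of 5 27] threshold_log_down[OF assms(1), of 6 31]
    threshold_log_up[OF assms(1), of 7 33] threshold_log_down[OF assms(1), of 8 36]
    threshold_log_down[OF assms(1), of 9 38] threshold_log_up[OF assms(1), of 10 39]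
    threshold_log_up[OF assms(1), of 11 41] threshold_log_down[OF assms(1), of 12 43]
    threshold_log_up[OF assms(1), of 13 44] threshold_log_up[OF assms(1), of 14 45]
    threshold_log_up[OF assms(1), of 15 46] threshold_log_down[OF assms(1), of 16 48]
  by simp_all

lemma twelve_log_gap:
  assumes "i \<ge> 17" shows "12 * log 2 (real (Suc i)) < 12 * log 2 (real i) + 1"
proof -
  \<comment> \<open>The ratio \<open>(i + 1) / i\<close> is at most \<open>18/17\<close>, and \<open>(18/17)\<^sup>1\<^sup>2\<close> is about 1.986.\<close>
  have "(17 * Suc i) ^ 12 \<le> (18 * i) ^ 12" using assms by (intro power_mono) auto
  then have "17 ^ 12 * Suc i ^ 12 \<le> 18 ^ 12 * i ^ 12" by (simp only: power_mult_distrib)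
  moreover have "Y < X * 2" if "17 ^ 12 * Y \<le> 18 ^ 12 * X" "0 < X" for X Y :: nat
    using that by simp
  moreover have "0 < i ^ 12" using assms by simp
  ultimately have "Suc i ^ 12 < i ^ 12 * 2" by blast
  then show ?thesis using log_compare[of i "Suc i" 1 0] assms by simp
qed

text \<open>
  The last \<open>i\<close> with \<open>12 log i < n + \<alpha>\<close> is rounded to \<open>n\<close>: it is at least \<open>17\<close>, so the next value,
  which has reached \<open>n + \<alpha>\<close>, is less than \<open>1\<close> away.
\<close>
lemma threshold_log_onto:
  assumes \<alpha>: "harmonic_threshold \<alpha>" and "49 \<le> n"
  shows "\<exists>i\<ge>1. threshold_floor \<alpha> (12 * log 2 (real i)) = int n"
proof -
  let ?P = "\<lambda>k::nat. 1 \<le> k \<and> real n + \<alpha> \<le> 12 * log 2 (real k)"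
  have "?P (2 ^ n)"
    using assms harmonic_threshold_bounds[OF \<alpha>] by (auto simp: log_nat_power)
  then have P: "?P (LEAST k. ?P k)" by (rule LeastI)
  define k where "k = (LEAST k. ?P k)"
  have "k > 17"
  proof (rule ccontr)
    assume "\<not> k > 17"
    then have "12 * log 2 (real k) \<le> 12 * log 2 (real 17)" using P unfolding k_def by simp
    then show False using P \<alpha> \<open>49 \<le> n\<close> unfolding k_def harmonic_threshold_def by linarith
  qed
  then obtain i where i: "k = Suc i" "i \<ge> 17" by (cases k) auto
  have "\<not> ?P i" using i not_less_Least[of i ?P] unfolding k_def by auto
  then have "12 * log 2 (real i) < real n + \<alpha>" using i by auto
  moreover have "12 * log 2 (real i) > real n + \<alpha> - 1"
    using P twelve_log_gap[OF i(2)] i unfolding k_def by simp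
  ultimately have "threshold_floor \<alpha> (12 * log 2 (real i)) = int n"
    using harmonic_threshold_bounds[OF \<alpha>] by (intro threshold_floor_eqI) auto
  then show ?thesis using i by (intro exI[of _ i]) auto
qed

lemma discretized_log:
  assumes \<alpha>: "harmonic_threshold \<alpha>"
  shows "discretized \<alpha> 12 logarithmic_monoid = int ` well_tempered_harmonic_semigroup"
proof -
  define T where "T i = threshold_floor \<alpha> (12 * log 2 (real i))" for i :: nat
  note small = threshold_log_small[OF \<alpha>, folded T_def]
  have disc: "discretized \<alpha> 12 logarithmic_monoid = T ` {1..}"
    by (auto simp: discretized_def logarithmic_monoid_def T_def)
  have "T i \<in> int ` well_tempered_harmonic_semigroup" if "i \<ge> 1" for i
  proof (cases "i \<le> 16")
    case True
    then have "i \<in> {1..16}" using that by simp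
    then have "i \<in> {1,2,3,4,5,6,7,8,9,10,11,12,13,14,15,16}" by (simp; presburger)
    then show ?thesis using small unfolding int_mem_harmonic_iff by auto
  next
    case False
    then have "12 * log 2 (real 17) \<le> 12 * log 2 (real i)" by simp
    then have "49 \<le> 12 * log 2 (real i)" using log_ge_iff[of 17 49] by simp
    then have "T i \<ge> 49"
      using threshold_floor_eqD(2)[of \<alpha> "12 * log 2 (real i)", OF refl]
        threshold_floor_eqD(4)[of \<alpha> "12 * log 2 (real i)", OF refl]
      unfolding T_def by linarith
    then show ?thesis unfolding int_mem_harmonic_iff by simp
  qed
  moreover have "int n \<in> T ` {1..}" if "n \<in> well_tempered_harmonic_semigroup" for n
  proof (cases "n \<ge> 49")
    case True
    then obtain i where "i \<ge> 1" "T i = int n"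
      using threshold_log_onto[OF \<alpha>] unfolding T_def by blast
    then show ?thesis by (intro image_eqI[of _ _ i]) auto
  next
    case False
    then have "n \<in> {0,12,19,24,28,31,34,36,38,40,42,43,45,46,47,48}"
      using that by (auto simp: well_tempered_harmonic_semigroup_def)
    moreover have "T i \<in> T ` {1..}" if "i \<ge> 1" for i using that by auto
    note this[of 1] this[of 2] this[of 3] this[of 4] this[of 5] this[of 6] this[of 7] this[of 8]
      this[of 9] this[of 10] this[of 11] this[of 12] this[of 13] this[of 14] this[of 15] this[of 16]
    ultimately show ?thesis unfolding small by auto
  qed
  ultimately show ?thesis unfolding disc by auto
qed

section \<open>The golden fractal monoid\<close>

definition golden_section :: real where "golden_section = golden_ratio - 1"

lemma golden_section_square: "golden_section * golden_section = 1 - golden_section"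
  by (simp add: golden_section_def golden_ratio_def field_simps)

text \<open>
  The tightest floor to be computed is that of \<open>12 (8 - 12 g)\<close>, which lies only 0.0031 above the
  integer \<open>7\<close>, while the error of \<open>g\<close> is multiplied by \<open>144\<close> there.
\<close>
lemma golden_section_bounds: "0.618033 < golden_section" "golden_section < 0.618034"
proof -
  have "2.236067 < sqrt 5" by (rule real_less_rsqrt) (simp add: power2_eq_square)
  then show "0.618033 < golden_section" by (simp add: golden_section_def golden_ratio_def)
  have "sqrt 5 < 2.236068" by (rule real_less_lsqrt) (simp_all add: power2_eq_square)
  then show "golden_section < 0.618034" by (simp add: golden_section_def golden_ratio_def)
qed

text \<open>
  Each period is the set of left end points of a partition of the unit interval. Passing to the next
  period divides every subinterval in the golden section; a list of all end points, including the
  final \<open>1\<close>, makes this a recursion over adjacent entries.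
\<close>
fun golden_refine :: "real list \<Rightarrow> real list" where
  "golden_refine [] = []"
| "golden_refine [a] = [a]"
| "golden_refine (a # b # xs) = a # (a + golden_section * (b - a)) # golden_refine (b # xs)"

lemma golden_refine_eq_Nil: "golden_refine xs = [] \<longleftrightarrow> xs = []"
  by (induction xs rule: golden_refine.induct) auto

lemma hd_golden_refine: "hd (golden_refine xs) = hd xs"
  by (induction xs rule: golden_refine.induct) auto

lemma last_golden_refine: "last (golden_refine xs) = last xs"
  by (induction xs rule: golden_refine.induct) (auto simp: golden_refine_eq_Nil)

lemma length_golden_refine: "length (golden_refine xs) = 2 * length xs - 1"
  by (induction xs rule: golden_refine.induct) auto

lemma set_butlast_golden_refine_superset: "set (butlast xs) \<subseteq> set (butlast (golden_refine xs))"
  by (induction xs rule: golden_refine.induct) (auto simp: golden_refine_eq_Nil)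

lemma sorted_golden_refine:
  "sorted_wrt (<) xs \<Longrightarrow> sorted_wrt (<) (golden_refine xs)"
proof (induction xs rule: golden_refine.induct)
  case (3 a b xs)
  let ?c = "a + golden_section * (b - a)"
  have "a < b" using 3 by simp
  moreover have "golden_section * (b - a) < 1 * (b - a)"
    using \<open>a < b\<close> golden_section_bounds by (intro mult_strict_right_mono) auto
  moreover have "golden_section * (b - a) > 0"
    using \<open>a < b\<close> golden_section_bounds by (intro mult_pos_pos) auto
  ultimately have c: "a < ?c" "?c < b" by (simp_all only: mult_1 less_diff_eq add.commute less_add_same_cancel1)
  have IH: "sorted_wrt (<) (golden_refine (b # xs))" using 3 by simp
  obtain ys where ys: "golden_refine (b # xs) = b # ys"
    using hd_golden_refine[of "b # xs"] golden_refine_eq_Nil[of "b # xs"]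
    by (cases "golden_refine (b # xs)") auto
  show ?case using IH c unfolding golden_refine.simps ys by auto
qed auto

lemma set_butlast_golden_refine:
  "set (butlast (golden_refine xs)) =
     (\<Union>r<length xs - 1. {xs ! r, xs ! r + golden_section * (xs ! (r + 1) - xs ! r)})"
proof (induction xs rule: golden_refine.induct)
  case (3 a b xs)
  have "{..<length (a # b # xs) - 1} = insert 0 (Suc ` {..<length (b # xs) - 1})"
    by (simp add: lessThan_Suc_eq_insert_0)
  then show ?case using 3 by (simp add: golden_refine_eq_Nil)
qed auto

fun golden_partition :: "nat \<Rightarrow> real list" where
  "golden_partition 0 = [0, 1]"
| "golden_partition (Suc n) = golden_refine (golden_partition n)"

lemma golden_partition_invariants:
  shows "sorted_wrt (<) (golden_partition n)" "length (golden_partition n) = 2 ^ n + 1"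
    "hd (golden_partition n) = 0" "last (golden_partition n) = 1" "golden_partition n \<noteq> []"
  by (induction n)
    (auto simp: sorted_golden_refine length_golden_refine hd_golden_refine last_golden_refine
      golden_refine_eq_Nil)

lemma golden_partition_butlast: "butlast (golden_partition n) @ [1] = golden_partition n"
  using golden_partition_invariants(4,5)[of n] by (metis append_butlast_last_id)

lemma golden_partition_range:
  assumes "t \<in> set (butlast (golden_partition n))" shows "0 \<le> t" "t < 1"
proof -
  let ?xs = "golden_partition n"
  have "sorted_wrt (<) (butlast ?xs @ [1])"
    unfolding golden_partition_butlast by (rule golden_partition_invariants)
  then show "t < 1" using assms by (auto simp: sorted_wrt_append)
  obtain ys where "?xs = 0 # ys"
    using golden_partition_invariants(3,5)[of n] by (cases ?xs) auto
  then show "0 \<le> t"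
    using assms golden_partition_invariants(1)[of n] in_set_butlastD[OF assms] by auto
qed

lemma golden_partition_mono:
  "m \<le> n \<Longrightarrow> set (butlast (golden_partition m)) \<subseteq> set (butlast (golden_partition n))"
  by (induction n rule: dec_induct) (use set_butlast_golden_refine_superset in auto)

text \<open>
  Since the partitions are strictly increasing and end in \<open>1\<close>, sorting the shifted period and
  appending \<open>1\<close> just recovers the partition. The recursion for periods is therefore the refinement
  of partitions.
\<close>
lemma golden_period_eq:
  "golden_period (Suc n) = (\<lambda>t. real (Suc n) + t) ` set (butlast (golden_partition (Suc n)))"
proof (induction n)
  case 0
  show ?case by (simp add: golden_section_def)
next
  case (Suc n)
  let ?xs = "golden_partition (Suc n)"
  have "(\<lambda>p. p - real (Suc n)) ` golden_period (Suc n) = set (butlast ?xs)"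
    unfolding Suc.IH by (simp add: image_image)
  moreover have "sorted_list_of_set (set (butlast ?xs)) = butlast ?xs"
  proof -
    have "sorted_wrt (<) (butlast ?xs @ [1])"
      unfolding golden_partition_butlast by (rule golden_partition_invariants)
    then have "sorted_wrt (<) (butlast ?xs)" by (simp only: sorted_wrt_append)
    then show ?thesis
      by (intro sorted_list_of_set.idem_if_sorted_distinct) (auto simp: strict_sorted_iff)
  qed
  ultimately have "sorted_list_of_set ((\<lambda>p. p - real (Suc n)) ` golden_period (Suc n)) @ [1] = ?xs"
    by (simp only: golden_partition_butlast)
  then have "golden_period (Suc (Suc n)) =
      (\<Union>r<2 ^ Suc n. {real (Suc (Suc n)) + ?xs ! r,
         real (Suc (Suc n)) + ?xs ! r + golden_section * (?xs ! (r + 1) - ?xs ! r)})"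
    unfolding golden_period.simps Let_def golden_section_def by (simp only: Suc_eq_plus1)
  also have "\<dots> = (\<lambda>t. real (Suc (Suc n)) + t) ` set (butlast (golden_refine ?xs))"
    unfolding set_butlast_golden_refine golden_partition_invariants(2) image_UN
    by (simp add: add.assoc)
  finally show ?case by simp
qed

text \<open>
  As \<open>g\<^sup>2 = 1 - g\<close>, all end points are integral combinations of \<open>1\<close> and \<open>g\<close>.
\<close>
lemma golden_partition_explicit:
  fixes g defines "g \<equiv> golden_section"
  shows "golden_partition 1 = [0, g, 1]"
    "golden_partition 2 = [0, 1 - g, g, 3 * g - 1, 1]"
    "golden_partition 3 = [0, 2 * g - 1, 1 - g, 3 - 4 * g, g, 2 - 2 * g, 3 * g - 1, 8 * g - 4, 1]"
    "golden_partition 4 = [0, 2 - 3 * g, 2 * g - 1, 7 * g - 4, 1 - g, 4 * g - 2, 3 - 4 * g,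
       8 - 12 * g, g, 6 * g - 3, 2 - 2 * g, 7 - 10 * g, 3 * g - 1, 4 - 5 * g, 8 * g - 4,
       21 * g - 12, 1]"
proof -
  have "g * (g * x) = x - g * x" for x
    using golden_section_square[folded g_def] by (simp add: left_diff_distrib flip: mult.assoc)
  note [simp] = this golden_section_square[folded g_def] algebra_simps
  show 1: "golden_partition 1 = [0, g, 1]"
    by (simp add: g_def)
  show 2: "golden_partition 2 = [0, 1 - g, g, 3 * g - 1, 1]"
    using 1 unfolding numeral_2_eq_2 golden_partition.simps(2)[of "Suc 0"] One_nat_def
    by (simp flip: g_def)
  show 3: "golden_partition 3 =
      [0, 2 * g - 1, 1 - g, 3 - 4 * g, g, 2 - 2 * g, 3 * g - 1, 8 * g - 4, 1]"
    using 2 unfolding numeral_3_eq_3 numeral_2_eq_2 golden_partition.simps(2)[of "Suc (Suc 0)"]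
    by (simp flip: g_def)
  have "golden_partition 4 = golden_refine (golden_partition 3)"
    using golden_partition.simps(2)[of 3] by simp
  then show "golden_partition 4 = [0, 2 - 3 * g, 2 * g - 1, 7 * g - 4, 1 - g, 4 * g - 2, 3 - 4 * g,
       8 - 12 * g, g, 6 * g - 3, 2 - 2 * g, 7 - 10 * g, 3 * g - 1, 4 - 5 * g, 8 * g - 4,
       21 * g - 12, 1]"
    unfolding 3 by (simp flip: g_def)
qed

lemma golden_period_bounds:
  assumes "x \<in> golden_period i" shows "real i \<le> x" "x < real i + 1"
proof -
  obtain n where "i = Suc n" using assms by (cases i) auto
  then show "real i \<le> x" "x < real i + 1"
    using assms golden_partition_range[of _ "Suc n"] unfolding \<open>i = Suc n\<close> golden_period_eq by auto
qed

text \<open>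
  Refining keeps all end points, so a point of one period reappears, translated by an integer, in
  all later ones.
\<close>
lemma golden_fractal_memI:
  assumes "i \<ge> n" "n \<ge> 1" "t \<in> set (butlast (golden_partition n))"
  shows "real i + t \<in> golden_fractal_monoid"
proof -
  have "i = Suc (i - 1)" using assms by simp
  then have "real i + t \<in> golden_period i"
    using golden_period_eq[of "i - 1"] golden_partition_mono[OF assms(1)] assms(3) by auto
  then show ?thesis unfolding golden_fractal_monoid_def using assms by auto
qed

lemma golden_fractal_cases:
  assumes "x \<in> golden_fractal_monoid"
  defines "g \<equiv> golden_section"
  obtains "x = 0" | "x \<in> {1, 1 + g}" | "x \<in> {2, 3 - g, 2 + g, 1 + 3 * g}"
    | "x \<in> {3, 2 + 2 * g, 4 - g, 6 - 4 * g, 3 + g, 5 - 2 * g, 2 + 3 * g, 8 * g - 1}" | "x \<ge> 4"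
proof -
  have period: "golden_period i = (\<lambda>t. real i + t) ` set (butlast (golden_partition i))"
    if "i \<ge> 1" for i
    using golden_period_eq[of "i - 1"] that by simp
  consider "x = 0" | i where "i \<ge> 1" "x \<in> golden_period i"
    using assms(1) unfolding golden_fractal_monoid_def by auto
  then show ?thesis
  proof cases
    case 2
    then consider "i = 1" | "i = 2" | "i = 3" | "i \<ge> 4" by linarith
    then show ?thesis
    proof cases
      case 1
      then show ?thesis using 2 that(2) unfolding period[OF 2(1)]
        by (auto simp: golden_partition_explicit g_def simp del: One_nat_def)
    next
      assume "i = 2"
      then show ?thesis using 2 that(3) unfolding period[OF 2(1)]
        by (auto simp: golden_partition_explicit g_def)
    next
      assume "i = 3"
      then show ?thesis using 2 that(4) unfolding period[OF 2(1)]
        by (auto simp: golden_partition_explicit g_def)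
    next
      case 4
      then show ?thesis using golden_period_bounds(1)[OF 2(2)] that(5) by linarith
    qed
  qed (use that in auto)
qed

lemma golden_fractal_explicit:
  fixes g defines "g \<equiv> golden_section"
  shows "{0, 1, 1 + g, 2, 3 - g, 2 + g, 1 + 3 * g, 3, 2 + 2 * g, 4 - g, 6 - 4 * g, 3 + g,
    5 - 2 * g, 2 + 3 * g, 8 * g - 1} \<subseteq> golden_fractal_monoid"
proof -
  note m = golden_fractal_memI[OF order_refl]
  have "\<forall>t\<in>set (butlast (golden_partition 1)). real 1 + t \<in> golden_fractal_monoid"
    "\<forall>t\<in>set (butlast (golden_partition 2)). real 2 + t \<in> golden_fractal_monoid"
    "\<forall>t\<in>set (butlast (golden_partition 3)). real 3 + t \<in> golden_fractal_monoid"
    by (intro ballI m; simp)+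
  moreover have "0 \<in> golden_fractal_monoid" by (simp add: golden_fractal_monoid_def)
  ultimately show ?thesis
    unfolding golden_partition_explicit g_def by (simp add: algebra_simps)
qed

lemma golden_floor_onto:
  assumes "n \<ge> 48"
  shows "\<exists>x\<in>golden_fractal_monoid. \<lfloor>12 * x\<rfloor> = int n"
proof -
  define g where "g = golden_section"
  note b = golden_section_bounds[folded g_def]
  \<comment> \<open>Every residue \<open>k\<close> modulo \<open>12\<close> is the floor of \<open>12 t\<close> for one of the sixteen end points \<open>t\<close>.\<close>
  have "n mod 12 \<in> {0..<12}" by simp
  then have "n mod 12 \<in> {0,1,2,3,4,5,6,7,8,9,10,11}" by (simp; presburger)
  moreover have "\<lfloor>0::real\<rfloor> = 0" "\<lfloor>12 * (2 - 3 * g)\<rfloor> = 1" "\<lfloor>12 * (2 * g - 1)\<rfloor> = 2"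
    "\<lfloor>12 * (7 * g - 4)\<rfloor> = 3" "\<lfloor>12 * (1 - g)\<rfloor> = 4" "\<lfloor>12 * (4 * g - 2)\<rfloor> = 5"
    "\<lfloor>12 * (3 - 4 * g)\<rfloor> = 6" "\<lfloor>12 * (8 - 12 * g)\<rfloor> = 7" "\<lfloor>12 * (6 * g - 3)\<rfloor> = 8"
    "\<lfloor>12 * (2 - 2 * g)\<rfloor> = 9" "\<lfloor>12 * (3 * g - 1)\<rfloor> = 10" "\<lfloor>12 * (8 * g - 4)\<rfloor> = 11"
    using b by (simp_all add: floor_eq_iff)
  ultimately have "\<exists>t\<in>set (butlast (golden_partition 4)). \<lfloor>12 * t\<rfloor> = int (n mod 12)"
    unfolding golden_partition_explicit g_def by (elim insertE emptyE) simp_all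
  then obtain t where t: "t \<in> set (butlast (golden_partition 4))" "\<lfloor>12 * t\<rfloor> = int (n mod 12)"
    by blast
  have "\<lfloor>12 * (real (n div 12) + t)\<rfloor> = \<lfloor>12 * t + of_int (12 * int (n div 12))\<rfloor>"
    by (simp add: algebra_simps)
  also have "\<dots> = int (n mod 12) + 12 * int (n div 12)"
    unfolding floor_add_int[symmetric] t ..
  also have "\<dots> = int n" by presburger
  finally have "\<lfloor>12 * (real (n div 12) + t)\<rfloor> = int n" .
  moreover have "real (n div 12) + t \<in> golden_fractal_monoid"
    by (rule golden_fractal_memI[OF _ _ t(1)]) (use assms in auto)
  ultimately show ?thesis by blast
qed

lemma discretized_golden:
  "discretized 1 12 golden_fractal_monoid = int ` well_tempered_harmonic_semigroup"
proof -
  define g where "g = golden_section"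
  note b = golden_section_bounds[folded g_def]
  have fl: "\<lfloor>12 * (1 + g)\<rfloor> = 19" "\<lfloor>12 * (3 - g)\<rfloor> = 28" "\<lfloor>12 * (2 + g)\<rfloor> = 31"
    "\<lfloor>12 * (1 + 3 * g)\<rfloor> = 34" "\<lfloor>12 * (2 + 2 * g)\<rfloor> = 38" "\<lfloor>12 * (4 - g)\<rfloor> = 40"
    "\<lfloor>12 * (6 - 4 * g)\<rfloor> = 42" "\<lfloor>12 * (3 + g)\<rfloor> = 43" "\<lfloor>12 * (5 - 2 * g)\<rfloor> = 45"
    "\<lfloor>12 * (2 + 3 * g)\<rfloor> = 46" "\<lfloor>12 * (8 * g - 1)\<rfloor> = 47"
    "\<lfloor>12 * (0::real)\<rfloor> = 0" "\<lfloor>12 * (1::real)\<rfloor> = 12" "\<lfloor>12 * (2::real)\<rfloor> = 24" "\<lfloor>12 * (3::real)\<rfloor> = 36"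
    using b by (simp_all add: floor_eq_iff)
  let ?F = "\<lambda>x. \<lfloor>12 * x\<rfloor>"
  have disc: "discretized 1 12 golden_fractal_monoid = ?F ` golden_fractal_monoid"
    by (auto simp: discretized_def threshold_floor_one)
  have "?F x \<in> int ` well_tempered_harmonic_semigroup" if "x \<in> golden_fractal_monoid" for x
    using that
  proof (cases rule: golden_fractal_cases)
    case 5
    then have "45 \<le> ?F x" by linarith
    then show ?thesis unfolding int_mem_harmonic_iff by blast
  next
    case 1
    then show ?thesis by (simp add: int_mem_harmonic_iff)
  next
    case 2
    then show ?thesis unfolding g_def[symmetric] int_mem_harmonic_iff
      by (elim insertE emptyE; simp only: fl; simp)
  next
    case 3
    then show ?thesis unfolding g_def[symmetric] int_mem_harmonic_iff
      by (elim insertE emptyE; simp only: fl; simp)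
  next
    case 4
    then show ?thesis unfolding g_def[symmetric] int_mem_harmonic_iff
      by (elim insertE emptyE; simp only: fl; simp)
  qed
  moreover have "int n \<in> ?F ` golden_fractal_monoid" if "n \<in> well_tempered_harmonic_semigroup" for n
  proof (cases "n \<ge> 48")
    case True
    then show ?thesis using golden_floor_onto[OF True] by force
  next
    case False
    then have "n \<in> {0,12,19,24,28,31,34,36,38,40,42,43,45,46,47}"
      using that by (auto simp: well_tempered_harmonic_semigroup_def)
    then have "int n \<in> ?F ` {0, 1, 1 + g, 2, 3 - g, 2 + g, 1 + 3 * g, 3, 2 + 2 * g, 4 - g,
        6 - 4 * g, 3 + g, 5 - 2 * g, 2 + 3 * g, 8 * g - 1}"
      unfolding image_insert image_empty fl by auto
    then show ?thesis using golden_fractal_explicit[folded g_def] by blast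
  qed
  ultimately show ?thesis unfolding disc by auto
qed

section \<open>Existence and uniqueness\<close>

lemma numerical_semigroup_harmonic: "numerical_semigroup well_tempered_harmonic_semigroup"
proof -
  have "- well_tempered_harmonic_semigroup \<subseteq> {..<45}"
    by (auto simp: well_tempered_harmonic_semigroup_def)
  then have "finite (- well_tempered_harmonic_semigroup)" by (rule finite_subset) simp
  then show ?thesis
    by (auto simp: numerical_semigroup_def well_tempered_harmonic_semigroup_def)
qed

lemma multiplicity_harmonic: "semigroup_multiplicity well_tempered_harmonic_semigroup = 12"
  unfolding semigroup_multiplicity_def
  by (rule Least_equality) (auto simp: well_tempered_harmonic_semigroup_def)

text \<open>
  The fractional part of \<open>12 log 17\<close> is smaller than that of \<open>12 log 13\<close>.
\<close>
lemma harmonic_threshold_exists: "\<exists>\<alpha>\<in>{0..1}. harmonic_threshold \<alpha>"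
proof -
  let ?\<alpha> = "12 * log 2 (real 13) - 44"
  have "\<not> 12 * log 2 (real 13) + real 49 \<le> 12 * log 2 (real 17) + real 44"
    by (subst log_compare) simp_all
  then have "harmonic_threshold ?\<alpha>" unfolding harmonic_threshold_def by simp
  then show ?thesis using harmonic_threshold_bounds[of ?\<alpha>] by force
qed

lemma log_discretization_memI:
  assumes "int ` S = discretized \<alpha> 12 logarithmic_monoid"
    and "threshold_floor \<alpha> (12 * log 2 (real i)) = int n" "i \<ge> 1"
  shows "n \<in> S"
  using assms(2,3) unfolding mem_discretized_nat[OF assms(1)] logarithmic_monoid_def
  by (intro bexI[of _ "log 2 (real i)"]) auto

lemma log_discretization_preimage:
  assumes S: "int ` S = discretized \<alpha> 12 logarithmic_monoid" and "n \<in> S" "n \<ge> 1"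
  obtains i where "i \<ge> 1" "threshold_floor \<alpha> (12 * log 2 (real i)) = int n"
    "2 ^ (n - 1) < i ^ 12" "i ^ 12 < 2 ^ (n + 1)"
proof -
  obtain i where i: "i \<ge> 1" "threshold_floor \<alpha> (12 * log 2 (real i)) = int n"
    using assms(2) unfolding mem_discretized_nat[OF S] logarithmic_monoid_def by auto
  have "\<not> 12 * log 2 (real i) \<le> real (n - 1)" "\<not> real (n + 1) \<le> 12 * log 2 (real i)"
    using threshold_floor_eqD(1,2)[OF i(2)] \<open>n \<ge> 1\<close> by (auto simp: of_nat_diff)
  then show ?thesis
    using that[OF i] i(1) log_le_iff[of i "n - 1"] log_ge_iff[of i "n + 1"] by auto
qed

lemma nat_twelfth_root_unique:
  fixes i k :: nat
  assumes "a < i ^ 12" "i ^ 12 < b" "b \<le> (k + 2) ^ 12" "k ^ 12 \<le> a"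
  shows "i = k + 1"
proof -
  have "k ^ 12 < i ^ 12" "i ^ 12 < (k + 2) ^ 12" using assms by linarith+
  then have "k < i" "i < k + 2" by (auto dest: power_less_imp_less_base)
  then show ?thesis by simp
qed

text \<open>
  Only \<open>17\<close> can produce \<open>49\<close>, by being rounded down; this is the lower bound. The number \<open>45\<close> may
  come from \<open>12 log 13 = 44.41\<close>, rounded up, which is the upper bound, or from
  \<open>12 log 14 = 45.69\<close>, rounded down. The second possibility is excluded by \<open>34\<close>: it only arises by
  rounding up \<open>12 log 7 = 12 log 14 - 12\<close>, which has the same fractional part.
\<close>
lemma harmonic_thresholdI:
  assumes S: "int ` S = discretized \<alpha> 12 logarithmic_monoid"
    and "34 \<in> S" "45 \<in> S" "49 \<in> S"
  shows "harmonic_threshold \<alpha>"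
proof -
  obtain i where i: "threshold_floor \<alpha> (12 * log 2 (real i)) = int 34"
    "2 ^ 33 < i ^ 12" "i ^ 12 < 2 ^ 35"
    using log_discretization_preimage[OF S \<open>34 \<in> S\<close>] by auto
  have "i = 7" using nat_twelfth_root_unique[OF i(2,3), of 6] by simp
  then have 34: "\<alpha> \<le> 12 * log 2 (real 7) - 33"
    using threshold_floor_eqD(4)[OF i(1)] log_ge_iff[of 7 34] by simp
  obtain j where j: "threshold_floor \<alpha> (12 * log 2 (real j)) = int 45"
    "2 ^ 44 < j ^ 12" "j ^ 12 < 2 ^ 46"
    using log_discretization_preimage[OF S \<open>45 \<in> S\<close>] by auto
  have "12 < j" "j < 15"
    using j(2,3) power_less_imp_less_base[of 12 12 j] power_less_imp_less_base[of j 12 15] by auto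
  moreover have "j \<noteq> 14"
  proof
    assume "j = 14"
    then have "12 * log 2 (real 14) < 45 + \<alpha>"
      using threshold_floor_eqD(3)[OF j(1)] log_le_iff[of 14 45] by simp
    moreover have "12 * log 2 (real 7) + real 45 \<le> 12 * log 2 (real 14) + real 33"
      by (subst log_compare) simp_all
    ultimately show False using 34 by simp
  qed
  ultimately have "j = 13" by simp
  then have 45: "\<alpha> \<le> 12 * log 2 (real 13) - 44"
    using threshold_floor_eqD(4)[OF j(1)] log_ge_iff[of 13 45] by simp
  obtain k where k: "threshold_floor \<alpha> (12 * log 2 (real k)) = int 49"
    "2 ^ 48 < k ^ 12" "k ^ 12 < 2 ^ 50"
    using log_discretization_preimage[OF S \<open>49 \<in> S\<close>] by auto
  have "k = 17" using nat_twelfth_root_unique[OF k(2,3), of 16] by simp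
  then have "12 * log 2 (real 17) < 49 + \<alpha>"
    using threshold_floor_eqD(3)[OF k(1)] log_le_iff[of 17 49] by simp
  then show ?thesis using 45 by (simp add: harmonic_threshold_def)
qed

lemma golden_discretization_memI:
  assumes "int ` S = discretized \<beta> 12 golden_fractal_monoid" "x \<in> golden_fractal_monoid"
    and "real n \<le> 12 * x" "12 * x < real n + \<beta>" "\<beta> \<le> 1"
  shows "n \<in> S"
proof -
  have "threshold_floor \<beta> (12 * x) = int n"
    using assms by (intro threshold_floor_eqI) auto
  then show ?thesis using assms(2) by (auto simp: mem_discretized_nat[OF assms(1)])
qed

text \<open>
  The scaled elements of the golden fractal monoid around \<open>28\<close> are \<open>24\<close>, \<open>28.58\<close> and \<open>31.42\<close>, those
  around \<open>38\<close> are \<open>36\<close>, \<open>38.83\<close> and \<open>40.58\<close>. So \<open>28\<close> and \<open>38\<close> can only arise by rounding down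
  \<open>28.58\<close> and \<open>38.83\<close>.
\<close>
lemma golden_discretization_lower_bound:
  assumes S: "int ` S = discretized \<beta> 12 golden_fractal_monoid"
  defines "g \<equiv> golden_section"
  shows "28 \<in> S \<Longrightarrow> 12 * (3 - g) < 28 + \<beta>" "38 \<in> S \<Longrightarrow> 12 * (2 + 2 * g) < 38 + \<beta>"
proof -
  note b = golden_section_bounds[folded g_def]
  show "12 * (3 - g) < 28 + \<beta>" if mem: "28 \<in> S"
  proof -
    obtain x where x: "x \<in> golden_fractal_monoid" "threshold_floor \<beta> (12 * x) = int 28"
      using mem by (auto simp: mem_discretized_nat[OF S])
    note d = threshold_floor_eqD[OF x(2)]
    have "x = 3 - g" using x(1)
      by (cases rule: golden_fractal_cases) (use d(1,2) b in \<open>auto simp flip: g_def\<close>)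
    then show ?thesis using d(3) b by simp
  qed
  show "12 * (2 + 2 * g) < 38 + \<beta>" if mem: "38 \<in> S"
  proof -
    obtain x where x: "x \<in> golden_fractal_monoid" "threshold_floor \<beta> (12 * x) = int 38"
      using mem by (auto simp: mem_discretized_nat[OF S])
    note d = threshold_floor_eqD[OF x(2)]
    have "x = 2 + 2 * g" using x(1)
      by (cases rule: golden_fractal_cases) (use d(1,2) b in \<open>auto simp flip: g_def\<close>)
    then show ?thesis using d(3) b by simp
  qed
qed

text \<open>
  If \<open>\<alpha>\<close> is too small for \<open>12 log 3\<close> to be rounded to \<open>19\<close>, the golden fractal monoid supplies \<open>19\<close>
  instead.
\<close>
lemma common_discretization_contains_19:
  assumes L: "int ` S = discretized \<alpha> 12 logarithmic_monoid" "0 \<le> \<alpha>" "\<alpha> \<le> 1"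
    and F: "int ` S = discretized \<beta> 12 golden_fractal_monoid" "\<beta> \<le> 1"
  shows "19 \<in> S"
proof (cases "12 * log 2 (real 3) < 19 + \<alpha>")
  case True
  then have "threshold_floor \<alpha> (12 * log 2 (real 3)) = int 19"
    using log_ge_iff[of 3 19] L by (intro threshold_floor_eqI) auto
  then show ?thesis by (intro log_discretization_memI[OF L(1), of 3]) simp_all
next
  \<comment> \<open>Otherwise \<open>\<alpha>\<close> is at most the fractional part of \<open>12 log 3\<close>, hence at most that of \<open>12 log 5\<close>.\<close>
  case False
  have "12 * log 2 (real 3) + real 27 \<le> 12 * log 2 (real 5) + real 19"
    by (subst log_compare) simp_all
  then have "threshold_floor \<alpha> (12 * log 2 (real 5)) = int 28"
    using False L log_le_iff[of 5 27] log_le_iff[of 5 28] log_ge_iff[of 5 28]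
    by (intro threshold_floor_eqI) auto
  then have "28 \<in> S" by (intro log_discretization_memI[OF L(1), of 5]) simp_all
  \<comment> \<open>The fractional part of \<open>12 (1 + g) = 19.42\<close> is smaller than that of \<open>12 (3 - g) = 28.58\<close>.\<close>
  then have "12 * (3 - golden_section) < 28 + \<beta>"
    by (rule golden_discretization_lower_bound[OF F(1)])
  then show ?thesis using golden_fractal_explicit golden_section_bounds F
    by (intro golden_discretization_memI[OF F(1), of "1 + golden_section"]) auto
qed

lemma common_discretization_unique:
  assumes S: "numerical_semigroup S"
    and L: "int ` S = discretized \<alpha> 12 logarithmic_monoid" "0 \<le> \<alpha>" "\<alpha> \<le> 1"
    and F: "int ` S = discretized \<beta> 12 golden_fractal_monoid" "\<beta> \<le> 1"
  shows "S = well_tempered_harmonic_semigroup"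
proof -
  define g where "g = golden_section"
  note b = golden_section_bounds[folded g_def]
  have "19 \<in> S" using common_discretization_contains_19[OF L F] .
  then have "19 + 19 \<in> S" using S unfolding numerical_semigroup_def by blast
  then have \<beta>: "12 * (2 + 2 * g) < 38 + \<beta>"
    using golden_discretization_lower_bound(2)[OF F(1)] by (simp add: g_def)
  \<comment> \<open>The points \<open>34.25\<close>, \<open>45.17\<close> and \<open>49.75\<close> have a smaller fractional part than \<open>38.83\<close>.\<close>
  have "34 \<in> S" "45 \<in> S"
    using golden_fractal_explicit[folded g_def] \<beta> b F
    by (auto intro: golden_discretization_memI[OF F(1), of "1 + 3 * g"]
      golden_discretization_memI[OF F(1), of "5 - 2 * g"])
  moreover have "2 - 3 * g \<in> set (butlast (golden_partition 4))"
    by (simp add: golden_partition_explicit g_def)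
  then have "real 4 + (2 - 3 * g) \<in> golden_fractal_monoid" by (intro golden_fractal_memI) auto
  then have "49 \<in> S"
    using \<beta> b F by (intro golden_discretization_memI[OF F(1), of "real 4 + (2 - 3 * g)"]) auto
  ultimately have "harmonic_threshold \<alpha>" by (intro harmonic_thresholdI[OF L(1)])
  then have "int ` S = int ` well_tempered_harmonic_semigroup" using discretized_log L(1) by simp
  then show ?thesis by (simp add: inj_image_eq_iff)
qed

theorem theorem7p3:
  fixes S :: "nat set"
  shows "numerical_semigroup S \<and> semigroup_multiplicity S = 12 \<and>
         is_discretization S logarithmic_monoid \<and>
         is_discretization S golden_fractal_monoid
         \<longleftrightarrow> S = well_tempered_harmonic_semigroup"
proof
  assume S: "S = well_tempered_harmonic_semigroup"
  obtain \<alpha> where "\<alpha> \<in> {0..1}" "harmonic_threshold \<alpha>" using harmonic_threshold_exists by blast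
  then have "is_discretization S logarithmic_monoid"
    unfolding is_discretization_def S multiplicity_harmonic
    using numerical_semigroup_harmonic discretized_log by metis
  moreover have "is_discretization S golden_fractal_monoid"
    unfolding is_discretization_def S multiplicity_harmonic
    using numerical_semigroup_harmonic discretized_golden by force
  ultimately show "numerical_semigroup S \<and> semigroup_multiplicity S = 12 \<and>
      is_discretization S logarithmic_monoid \<and> is_discretization S golden_fractal_monoid"
    using numerical_semigroup_harmonic multiplicity_harmonic S by simp
next
  assume S: "numerical_semigroup S \<and> semigroup_multiplicity S = 12 \<and>
      is_discretization S logarithmic_monoid \<and> is_discretization S golden_fractal_monoid"
  then obtain \<alpha> \<beta> where "\<alpha> \<in> {0..1}" "int ` S = discretized \<alpha> 12 logarithmic_monoid"
    "\<beta> \<in> {0..1}" "int ` S = discretized \<beta> 12 golden_fractal_monoid"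
    unfolding is_discretization_def by auto
  then show "S = well_tempered_harmonic_semigroup"
    using common_discretization_unique S by simp
qed

end
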